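(* Let $X$ and $Y$ be normed spaces. If a function $f:X\to Y$ is positively homogeneous at $\bar x\in X$, i.e. $$f(\bar x+\lambda(x-\bar x))=f(\bar x)+\lambda\,(f(x)-f(\bar x))\quad\text{for all }x\in X,\ \lambda>0,$$ then $f$ is semismooth* at $\bar x$.
   Context: The product $X\times Y$ carries the sum norm $\|(x,y)\|=\|x\|+\|y\|$, and its dual $X^*\times Y^*$ the maximum norm. For a subset $\Omega$ of a normed space $Z$, $z\in\Omega$ and $\varepsilon\ge0$, the set of Fréchet $\varepsilon$-normals is $N_{\Omega,\varepsilon}(z)=\{z^*\in Z^*: \limsup_{\Omega\ni w\to z,\,w\ne z}\frac{\langle z^*,w-z\rangle}{\|w-z\|}\le\varepsilon\}$. $\Omega$ is semismooth* at $\bar z\in\Omega$ if for every $\varepsilon>0$ there is $\delta>0$ such that $|\langle z^*,z-\bar z\rangle|\le\varepsilon\|z-\bar z\|$ for all $z\in\Omega$ with $\|z-\bar z\|<\delta$ and all $z^*\in N_{\Omega,\delta}(z)$ with $\|z^*\|=1$. A function $f:X\to Y$ is semismooth* at $\bar x$ if its graph $\mathrm{gph} f$ is semismooth* at $(\bar x,f(\bar x))$. *)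

theory Defs
  imports "HOL-Analysis.Analysis"
begin

text \<open>The library's product type carries the Euclidean norm, so the product of two normed
  spaces with the sum norm is introduced as a type of its own.\<close>

datatype ('a, 'b) sum_prod = SPair (sfst: 'a) (ssnd: 'b)

instantiation sum_prod :: (real_vector, real_vector) real_vector
begin

definition "0 = SPair 0 0"
definition "z + w = SPair (sfst z + sfst w) (ssnd z + ssnd w)"
definition "- z = SPair (- sfst z) (- ssnd z)"
definition "z - w = SPair (sfst z - sfst w) (ssnd z - ssnd w)"
definition "r *\<^sub>R z = SPair (r *\<^sub>R sfst z) (r *\<^sub>R ssnd z)"

instance
  by standard (simp_all add: zero_sum_prod_def plus_sum_prod_def uminus_sum_prod_def
    minus_sum_prod_def scaleR_sum_prod_def algebra_simps)

end

instantiation sum_prod :: (real_normed_vector, real_normed_vector) real_normed_vector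
begin

definition "norm z = norm (sfst z) + norm (ssnd z)"
definition "sgn (z :: ('a, 'b) sum_prod) = z /\<^sub>R norm z"
definition "dist (z :: ('a, 'b) sum_prod) w = norm (z - w)"
definition "(uniformity :: (('a, 'b) sum_prod \<times> ('a, 'b) sum_prod) filter) =
  (INF e\<in>{0<..}. principal {(z, w). dist z w < e})"
definition "open (U :: ('a, 'b) sum_prod set) \<longleftrightarrow>
  (\<forall>z\<in>U. eventually (\<lambda>(z', w). z' = z \<longrightarrow> w \<in> U) uniformity)"

lemmas sum_prod_defs = zero_sum_prod_def plus_sum_prod_def uminus_sum_prod_def
  minus_sum_prod_def scaleR_sum_prod_def norm_sum_prod_def

instance
proof
  fix z w :: "('a, 'b) sum_prod" and r :: real and U :: "('a, 'b) sum_prod set"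
  show "norm z = 0 \<longleftrightarrow> z = 0"
    by (cases z) (simp add: sum_prod_defs add_nonneg_eq_0_iff)
  show "norm (z + w) \<le> norm z + norm w"
    using norm_triangle_ineq[of "sfst z" "sfst w"] norm_triangle_ineq[of "ssnd z" "ssnd w"]
    by (simp add: sum_prod_defs)
  show "norm (r *\<^sub>R z) = \<bar>r\<bar> * norm z"
    by (simp add: sum_prod_defs algebra_simps)
  show "open U \<longleftrightarrow> (\<forall>z\<in>U. \<forall>\<^sub>F (z', w) in uniformity. z' = z \<longrightarrow> w \<in> U)"
    by (fact open_sum_prod_def)
qed (fact sgn_sum_prod_def dist_sum_prod_def uniformity_sum_prod_def)+

end

lemma bounded_linear_SPair1: "bounded_linear (\<lambda>x. SPair x 0)"
  by (rule bounded_linear_intro[where K = 1]) (simp_all add: sum_prod_defs)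

lemma bounded_linear_SPair2: "bounded_linear (\<lambda>y. SPair 0 y)"
  by (rule bounded_linear_intro[where K = 1]) (simp_all add: sum_prod_defs)

text \<open>The dual norm induced by the sum norm is the maximum of the dual norms of the components.\<close>

lemma norm_dual_sum_prod:
  fixes g :: "('a::real_normed_vector, 'b::real_normed_vector) sum_prod \<Rightarrow>\<^sub>L real"
  shows "norm g = max (onorm (\<lambda>x. g (SPair x 0))) (onorm (\<lambda>y. g (SPair 0 y)))"
    (is "_ = max ?A ?B")
proof (rule antisym)
  have bA: "bounded_linear (\<lambda>x. g (SPair x 0))"
    by (rule bounded_linear_compose[OF blinfun.bounded_linear_right bounded_linear_SPair1])
  have bB: "bounded_linear (\<lambda>y. g (SPair 0 y))"
    by (rule bounded_linear_compose[OF blinfun.bounded_linear_right bounded_linear_SPair2])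
  have "0 \<le> ?A" by (rule onorm_pos_le[OF bA])
  show "norm g \<le> max ?A ?B"
  proof (rule norm_blinfun_bound)
    show "0 \<le> max ?A ?B" using \<open>0 \<le> ?A\<close> by simp
    fix z :: "('a, 'b) sum_prod"
    have "z = SPair (sfst z) 0 + SPair 0 (ssnd z)"
      by (simp add: sum_prod_defs)
    then have "g z = g (SPair (sfst z) 0) + g (SPair 0 (ssnd z))"
      by (metis blinfun.add_right)
    then have "norm (g z) \<le> norm (g (SPair (sfst z) 0)) + norm (g (SPair 0 (ssnd z)))"
      by (simp add: norm_triangle_ineq)
    also have "\<dots> \<le> ?A * norm (sfst z) + ?B * norm (ssnd z)"
      by (intro add_mono onorm[OF bA] onorm[OF bB])
    also have "\<dots> \<le> max ?A ?B * norm (sfst z) + max ?A ?B * norm (ssnd z)"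
      by (intro add_mono mult_right_mono) auto
    also have "\<dots> = max ?A ?B * norm z"
      by (simp add: norm_sum_prod_def algebra_simps)
    finally show "norm (g z) \<le> max ?A ?B * norm z" .
  qed
  have "?A \<le> norm g"
  proof (rule onorm_bound[OF norm_ge_zero])
    fix x show "norm (g (SPair x 0)) \<le> norm g * norm x"
      using norm_blinfun[of g "SPair x 0"] by (simp add: norm_sum_prod_def)
  qed
  moreover have "?B \<le> norm g"
  proof (rule onorm_bound[OF norm_ge_zero])
    fix y show "norm (g (SPair 0 y)) \<le> norm g * norm y"
      using norm_blinfun[of g "SPair 0 y"] by (simp add: norm_sum_prod_def)
  qed
  ultimately show "max ?A ?B \<le> norm g" by simp
qed

text \<open>The upper limit is taken in the extended reals: the quotients need not be bounded, and at
  an isolated point of \<open>\<Omega>\<close> the filter is trivial and the upper limit is \<open>-\<infinity>\<close>, so that every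
  functional is a normal there.\<close>

definition frechet_normals ::
  "'z::real_normed_vector set \<Rightarrow> real \<Rightarrow> 'z \<Rightarrow> ('z \<Rightarrow>\<^sub>L real) set" where
  "frechet_normals \<Omega> \<epsilon> z =
    {g. Limsup (at z within \<Omega>) (\<lambda>w. ereal (blinfun_apply g (w - z) / norm (w - z))) \<le> ereal \<epsilon>}"

definition semismooth_star_set :: "'z::real_normed_vector set \<Rightarrow> 'z \<Rightarrow> bool" where
  "semismooth_star_set \<Omega> zbar \<longleftrightarrow> zbar \<in> \<Omega> \<and>
    (\<forall>\<epsilon>>0. \<exists>\<delta>>0. \<forall>z\<in>\<Omega>. norm (z - zbar) < \<delta> \<longrightarrow>
      (\<forall>g\<in>frechet_normals \<Omega> \<delta> z. norm g = 1 \<longrightarrow>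
        \<bar>blinfun_apply g (z - zbar)\<bar> \<le> \<epsilon> * norm (z - zbar)))"

definition gph :: "('a \<Rightarrow> 'b) \<Rightarrow> ('a, 'b) sum_prod set" where
  "gph f = range (\<lambda>x. SPair x (f x))"

definition semismooth_star ::
  "('a::real_normed_vector \<Rightarrow> 'b::real_normed_vector) \<Rightarrow> 'a \<Rightarrow> bool" where
  "semismooth_star f xbar \<longleftrightarrow> semismooth_star_set (gph f) (SPair xbar (f xbar))"

definition positively_homogeneous_at ::
  "('a::real_vector \<Rightarrow> 'b::real_vector) \<Rightarrow> 'a \<Rightarrow> bool" where
  "positively_homogeneous_at f xbar \<longleftrightarrow>
    (\<forall>x. \<forall>r>0. f (xbar + r *\<^sub>R (x - xbar)) = f xbar + r *\<^sub>R (f x - f xbar))"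

end

theory Submission
  imports Defs
begin

text \<open>Positive homogeneity of \<open>f\<close> at \<open>xbar\<close> says that the graph of \<open>f\<close> is a cone with apex
  \<open>zbar = (xbar, f xbar)\<close>. The ray from the apex through a point \<open>z \<noteq> zbar\<close> of such a cone stays in
  the cone on both sides of \<open>z\<close>, so both \<open>z - zbar\<close> and its negative are directions along which
  \<open>z\<close> can be approached inside the cone. The difference quotient that defines an
  \<open>\<epsilon>\<close>-normal \<open>g\<close> is constant along each of these two segments
  (lemma \<open>frechet_normals_le_along_segment\<close>), which gives \<open>\<plusminus>g (z - zbar) \<le> \<epsilon> \<parallel>z - zbar\<parallel>\<close>. Hence
  semismoothness* at \<open>zbar\<close> holds with the choice \<open>\<delta> = \<epsilon>\<close>.\<close>

text \<open>At \<open>w = z + t v\<close> the difference quotient is \<open>g v / \<parallel>v\<parallel>\<close> for every \<open>t > 0\<close>, and such points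
  accumulate at \<open>z\<close> within \<open>\<Omega>\<close>, so this constant is a lower bound of the upper limit.\<close>

lemma frechet_normals_le_along_segment:
  fixes g :: "'z::real_normed_vector \<Rightarrow>\<^sub>L real"
  assumes g: "g \<in> frechet_normals \<Omega> \<epsilon> z"
    and seg: "\<forall>\<^sub>F t in at_right 0. z + t *\<^sub>R v \<in> \<Omega>"
  shows "blinfun_apply g v \<le> \<epsilon> * norm v"
proof (cases "v = 0")
  case False
  let ?q = "\<lambda>w. ereal (blinfun_apply g (w - z) / norm (w - z))"
  let ?c = "ereal (blinfun_apply g v / norm v)"
  have "((\<lambda>t. z + t *\<^sub>R v) \<longlongrightarrow> z + 0 *\<^sub>R v) (at_right 0)"
    by (intro tendsto_intros)
  moreover have "\<forall>\<^sub>F t in at_right 0. z + t *\<^sub>R v \<in> \<Omega> \<and> z + t *\<^sub>R v \<noteq> z"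
    using seg eventually_at_right_less[of "0::real"]
    by eventually_elim (use False in simp)
  ultimately have lim: "filterlim (\<lambda>t. z + t *\<^sub>R v) (at z within \<Omega>) (at_right 0)"
    by (simp add: filterlim_at)
  have "?c \<le> Limsup (at z within \<Omega>) ?q"
  proof (rule ccontr)
    assume "\<not> ?c \<le> Limsup (at z within \<Omega>) ?q"
    then have "\<forall>\<^sub>F w in at z within \<Omega>. ?q w < ?c"
      by (intro Limsup_lessD) simp
    then have "\<forall>\<^sub>F t in at_right 0. ?q (z + t *\<^sub>R v) < ?c"
      using lim by (rule eventually_compose_filterlim)
    then have "\<forall>\<^sub>F t in at_right (0::real). False"
      using eventually_at_right_less[of "0::real"]
      by eventually_elim (simp add: blinfun.scaleR_right)
    then show False by simp
  qed
  also have "\<dots> \<le> ereal \<epsilon>"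
    using g by (simp add: frechet_normals_def)
  finally show ?thesis
    using False by (simp add: divide_le_eq)
qed simp

lemma semismooth_star_set_cone:
  fixes \<Omega> :: "'z::real_normed_vector set"
  assumes apex: "zbar \<in> \<Omega>"
    and cone: "\<And>z r. z \<in> \<Omega> \<Longrightarrow> r > 0 \<Longrightarrow> zbar + r *\<^sub>R (z - zbar) \<in> \<Omega>"
  shows "semismooth_star_set \<Omega> zbar"
proof -
  have bound: "\<bar>blinfun_apply g (z - zbar)\<bar> \<le> \<epsilon> * norm (z - zbar)"
    if z: "z \<in> \<Omega>" and g: "g \<in> frechet_normals \<Omega> \<epsilon> z" for \<epsilon> z g
  proof -
    let ?u = "z - zbar"
    have ray: "z + t *\<^sub>R ?u \<in> \<Omega>" if "-1 < t" for t
    proof -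
      have "z + t *\<^sub>R ?u = zbar + (1 + t) *\<^sub>R ?u"
        by (simp add: algebra_simps)
      then show ?thesis
        using cone[OF z, of "1 + t"] that by simp
    qed
    have "\<forall>\<^sub>F t in at_right 0. z + t *\<^sub>R ?u \<in> \<Omega>"
      using eventually_at_right_less[of "0::real"] by eventually_elim (rule ray, simp)
    then have "blinfun_apply g ?u \<le> \<epsilon> * norm ?u"
      by (rule frechet_normals_le_along_segment[OF g])
    moreover have "\<forall>\<^sub>F t in at_right 0. z + t *\<^sub>R (- ?u) \<in> \<Omega>"
    proof -
      have "\<forall>\<^sub>F t in at_right (0::real). t < 1"
        by (rule order_tendstoD(2)[OF tendsto_ident_at]) simp
      then show ?thesis
        by eventually_elim (use ray[of "- t" for t] in \<open>simp add: algebra_simps\<close>)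
    qed
    then have "blinfun_apply g (- ?u) \<le> \<epsilon> * norm (- ?u)"
      by (rule frechet_normals_le_along_segment[OF g])
    then have "- blinfun_apply g ?u \<le> \<epsilon> * norm ?u"
      by (simp only: blinfun.minus_right norm_minus_cancel)
    ultimately show ?thesis by (rule abs_leI)
  qed
  then show ?thesis
    unfolding semismooth_star_set_def using apex by blast
qed

theorem corollary4p7:
  fixes f :: "'a::real_normed_vector \<Rightarrow> 'b::real_normed_vector" and xbar :: 'a
  assumes "positively_homogeneous_at f xbar"
  shows "semismooth_star f xbar"
  unfolding semismooth_star_def
proof (rule semismooth_star_set_cone)
  show "SPair xbar (f xbar) \<in> gph f"
    by (simp add: gph_def)
  fix z and r :: real
  assume "z \<in> gph f" and r: "r > 0"
  then obtain x where z: "z = SPair x (f x)"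
    by (auto simp: gph_def)
  have "f (xbar + r *\<^sub>R (x - xbar)) = f xbar + r *\<^sub>R (f x - f xbar)"
    using assms r by (simp add: positively_homogeneous_at_def)
  then have "SPair xbar (f xbar) + r *\<^sub>R (z - SPair xbar (f xbar))
      = SPair (xbar + r *\<^sub>R (x - xbar)) (f (xbar + r *\<^sub>R (x - xbar)))"
    by (simp add: z sum_prod_defs)
  then show "SPair xbar (f xbar) + r *\<^sub>R (z - SPair xbar (f xbar)) \<in> gph f"
    by (simp add: gph_def)
qed

end
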